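(* Let $k,t$ be coprime positive integers with $3\le k<t$, let $G(k,t)$ be the corresponding distance graph, and let $S=(1,1,2,2,2,\ldots)$ be the infinite sequence whose first two terms equal $1$ and all of whose other terms equal $2$. Then $$\chi_S(G(k,t))=\begin{cases}2 & \text{if } k+t \text{ is even},\\ 4 & \text{if } k+t \text{ is odd}.\end{cases}$$
   Context: For positive integers $k<t$, the distance graph $G(k,t)=G(\mathbb{Z},\{k,t\})$ is the infinite graph with vertex set $\mathbb{Z}$ in which $x,y\in\mathbb{Z}$ are adjacent if and only if $|x-y|\in\{k,t\}$. Let $G$ be a graph and $S=(s_1,s_2,\ldots)$ a non-decreasing sequence of positive integers. For a positive integer $\ell$, an $S$-packing $\ell$-coloring of $G$ is a map $f:V(G)\to\{1,\ldots,\ell\}$ such that for every $i\in\{1,\ldots,\ell\}$ and any two distinct vertices $u,v$ with $f(u)=f(v)=i$, the (shortest-path) distance between $u$ and $v$ in $G$ is greater than $s_i$. The $S$-packing chromatic number $\chi_S(G)$ is the smallest $\ell$ such that $G$ has an $S$-packing $\ell$-coloring. *)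

theory Defs
  imports "Graph_Theory.Shortest_Path" "HOL-Library.Extended_Nat"
begin

text \<open>An undirected graph is represented, as usual in \<^theory>\<open>Graph_Theory.Digraph\<close>,
  by a symmetric digraph: each edge is a pair of opposite arcs.\<close>

definition distance_graph :: "nat set \<Rightarrow> (int, int \<times> int) pre_digraph" where
  "distance_graph D =
    \<lparr>verts = UNIV, arcs = {(x, y). nat \<bar>x - y\<bar> \<in> D}, tail = fst, head = snd\<rparr>"

lemma sym_digraph_distance_graph: "sym_digraph (distance_graph D)"
  by unfold_locales (auto simp: distance_graph_def symmetric_conv abs_minus_commute)

lemma loopfree_distance_graph:
  assumes "0 \<notin> D"
  shows "loopfree_digraph (distance_graph D)"
  using assms by unfold_locales (auto simp: distance_graph_def)

lemma dominates_distance_graph_iff: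
  "x \<rightarrow>\<^bsub>distance_graph D\<^esub> y \<longleftrightarrow> nat \<bar>x - y\<bar> \<in> D"
  by (force simp: distance_graph_def arcs_ends_conv)

text \<open>The distance is the least number of arcs of a walk, that is, the shortest-path distance
  for unit weights; it is \<open>\<infinity>\<close> if there is no walk. The constant \<open>wf_digraph.\<mu>\<close> is meaningful
  only for well-formed digraphs.\<close>

definition graph_dist :: "('a, 'b) pre_digraph \<Rightarrow> 'a \<Rightarrow> 'a \<Rightarrow> ereal" where
  "graph_dist G u v = wf_digraph.\<mu> G (\<lambda>_. 1) u v"

text \<open>Sequences are indexed from 1, so that \<open>S i\<close> belongs to colour \<open>i\<close>; the value \<open>S 0\<close> is
  never used.\<close>

definition packing_coloring ::
  "('a, 'b) pre_digraph \<Rightarrow> (nat \<Rightarrow> nat) \<Rightarrow> nat \<Rightarrow> ('a \<Rightarrow> nat) \<Rightarrow> bool" where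
  "packing_coloring G S l f \<longleftrightarrow>
    (\<forall>v\<in>verts G. f v \<in> {1..l}) \<and>
    (\<forall>i\<in>{1..l}. \<forall>u\<in>verts G. \<forall>v\<in>verts G.
      u \<noteq> v \<and> f u = i \<and> f v = i \<longrightarrow> graph_dist G u v > ereal (real (S i)))"

text \<open>The infimum in \<^typ>\<open>enat\<close> is \<open>\<infinity>\<close> exactly if there is no packing colouring with finitely
  many colours, and is otherwise the minimum.\<close>

definition packing_chromatic_number :: "('a, 'b) pre_digraph \<Rightarrow> (nat \<Rightarrow> nat) \<Rightarrow> enat" where
  "packing_chromatic_number G S = Inf {enat l | l. l \<ge> 1 \<and> (\<exists>f. packing_coloring G S l f)}"

definition seq_1122 :: "nat \<Rightarrow> nat" where
  "seq_1122 i = (if i \<le> 2 then 1 else 2)"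

end

theory Submission
  imports Defs "HOL-Number_Theory.Cong"
begin

text \<open>
  \<open>G(k,t)\<close> is the square grid wrapped onto a cylinder. If \<open>k\<close> and \<open>t\<close> are odd, parity is a proper
  2-colouring. If \<open>k + t\<close> is odd, modulo \<open>n = k + t\<close> the graph becomes the cycle
  \<open>0, k, 2k, \<dots>\<close> of length \<open>n\<close>, because \<open>t\<close> is congruent to \<open>-k\<close>. Deleting the
  multiples of \<open>n\<close> therefore leaves a bipartite graph, and the even and the odd multiples are
  2-packings as their gaps are at least \<open>2n\<close>. Conversely, suppose that colour 3 is a 2-packing and
  colours 1 and 2 are independent. The four neighbours of a vertex of colour 3 are joined by the
  surrounding 8-cycle, which avoids colour 3, so they all have the same colour. Recolouring every
  vertex of colour 3 with the colour from \<open>{1, 2}\<close> opposite to its neighbours gives a proper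
  2-colouring of the whole graph, contradicting the closed walk of odd length \<open>t + k\<close> made of
  \<open>t\<close> steps \<open>k\<close> and \<open>k\<close> steps \<open>-t\<close>.
\<close>

section \<open>Small distances in terms of adjacency\<close>

lemma graph_dist_le_iff:
  assumes "wf_digraph G"
  shows "graph_dist G u v \<le> ereal (real n) \<longleftrightarrow> (\<exists>p. pre_digraph.awalk G u p v \<and> length p \<le> n)"
proof -
  interpret wf_digraph G by fact
  have cost: "awalk_cost (\<lambda>_. 1) p = real (length p)" for p :: "'b list"
    by (simp add: awalk_cost_def sum_list_triv)
  show ?thesis
  proof
    assume le: "graph_dist G u v \<le> ereal (real n)"
    show "\<exists>p. awalk u p v \<and> length p \<le> n"
    proof (rule ccontr)
      assume "\<nexists>p. awalk u p v \<and> length p \<le> n"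
      \<comment> \<open>Walk lengths are integers, so excluding lengths up to \<open>n\<close> keeps
        the infimum at \<open>n + 1\<close> or more.\<close>
      then have "ereal (real (Suc n)) \<le> graph_dist G u v"
        unfolding graph_dist_def \<mu>_def cost
        by (intro INF_greatest) (metis ereal_less_eq(3) mem_Collect_eq not_less_eq_eq of_nat_le_iff)
      with le have "ereal (real (Suc n)) \<le> ereal (real n)"
        by (rule order_trans[rotated])
      then show False by simp
    qed
  next
    assume "\<exists>p. awalk u p v \<and> length p \<le> n"
    then obtain p where "awalk u p v" "length p \<le> n" by blast
    then show "graph_dist G u v \<le> ereal (real n)"
      using min_cost_le_walk_cost[of u p v "\<lambda>_. 1"]
      unfolding graph_dist_def cost by (auto elim: order_trans)
  qed
qed

lemma graph_dist_gt_1_iff: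
  assumes "wf_digraph G" "u \<in> verts G" "u \<noteq> v"
  shows "graph_dist G u v > ereal (real 1) \<longleftrightarrow> \<not> u \<rightarrow>\<^bsub>G\<^esub> v"
proof -
  interpret wf_digraph G by fact
  have "(\<exists>p. awalk u p v \<and> length p \<le> 1) \<longleftrightarrow> u \<rightarrow>\<^bsub>G\<^esub> v"
  proof
    assume "\<exists>p. awalk u p v \<and> length p \<le> 1"
    then obtain p where p: "awalk u p v" "length p \<le> 1" by blast
    then show "u \<rightarrow>\<^bsub>G\<^esub> v"
      using \<open>u \<noteq> v\<close> by (cases p) (auto simp: awalk_simps intro: in_arcs_imp_in_arcs_ends)
  next
    assume "u \<rightarrow>\<^bsub>G\<^esub> v"
    then obtain e where "e \<in> arcs G" "tail G e = u" "head G e = v" by auto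
    then have "awalk u [e] v" by (auto simp: awalk_simps)
    then show "\<exists>p. awalk u p v \<and> length p \<le> 1" by (intro exI[of _ "[e]"]) simp
  qed
  then show ?thesis
    using graph_dist_le_iff[OF assms(1), of u v 1] by (auto simp: not_le[symmetric])
qed

lemma graph_dist_gt_2_iff:
  assumes "wf_digraph G" "u \<in> verts G" "u \<noteq> v"
  shows "graph_dist G u v > ereal (real 2) \<longleftrightarrow>
    \<not> u \<rightarrow>\<^bsub>G\<^esub> v \<and> (\<nexists>w. u \<rightarrow>\<^bsub>G\<^esub> w \<and> w \<rightarrow>\<^bsub>G\<^esub> v)"
proof -
  interpret wf_digraph G by fact
  have "(\<exists>p. awalk u p v \<and> length p \<le> 2) \<longleftrightarrow>
    u \<rightarrow>\<^bsub>G\<^esub> v \<or> (\<exists>w. u \<rightarrow>\<^bsub>G\<^esub> w \<and> w \<rightarrow>\<^bsub>G\<^esub> v)"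
  proof
    assume "\<exists>p. awalk u p v \<and> length p \<le> 2"
    then obtain p where p: "awalk u p v" "length p \<le> 2" by blast
    with \<open>u \<noteq> v\<close> obtain e q where q: "p = e # q" by (cases p) (auto simp: awalk_simps)
    with p have e: "u \<rightarrow>\<^bsub>G\<^esub> head G e" "awalk (head G e) q v" "length q \<le> 1"
      by (auto simp: awalk_simps intro: in_arcs_imp_in_arcs_ends)
    show "u \<rightarrow>\<^bsub>G\<^esub> v \<or> (\<exists>w. u \<rightarrow>\<^bsub>G\<^esub> w \<and> w \<rightarrow>\<^bsub>G\<^esub> v)"
    proof (cases q)
      case Nil
      with e show ?thesis by (auto simp: awalk_simps)
    next
      case (Cons e' r)
      with e have "head G e \<rightarrow>\<^bsub>G\<^esub> v"
        by (auto simp: awalk_simps intro: in_arcs_imp_in_arcs_ends)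
      with e(1) show ?thesis by blast
    qed
  next
    assume "u \<rightarrow>\<^bsub>G\<^esub> v \<or> (\<exists>w. u \<rightarrow>\<^bsub>G\<^esub> w \<and> w \<rightarrow>\<^bsub>G\<^esub> v)"
    then consider e where "e \<in> arcs G" "tail G e = u" "head G e = v"
      | e e' where "e \<in> arcs G" "tail G e = u" "e' \<in> arcs G" "head G e = tail G e'" "head G e' = v"
      by (auto simp: arcs_ends_conv)
    then show "\<exists>p. awalk u p v \<and> length p \<le> 2"
    proof cases
      case 1
      then have "awalk u [e] v" by (auto simp: awalk_simps)
      then show ?thesis by (intro exI[of _ "[e]"]) simp
    next
      case 2
      then have "awalk u [e, e'] v" by (auto simp: awalk_simps)
      then show ?thesis by (intro exI[of _ "[e, e']"]) simp
    qed
  qed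
  then show ?thesis
    using graph_dist_le_iff[OF assms(1), of u v 2] by (auto simp: not_le[symmetric])
qed

text \<open>This removes walks and \<open>ereal\<close> from all later arguments. Every colour
  forbids adjacency; only colours from 3 on also forbid a common neighbour \<open>w\<close>.\<close>

lemma packing_coloring_1122_iff:
  "packing_coloring (distance_graph D) seq_1122 l f \<longleftrightarrow>
    (\<forall>v. 1 \<le> f v \<and> f v \<le> l) \<and>
    (\<forall>u v. u \<noteq> v \<and> f u = f v \<longrightarrow> nat \<bar>u - v\<bar> \<notin> D) \<and>
    (\<forall>u v w. u \<noteq> v \<and> f u = f v \<and> 3 \<le> f u \<longrightarrow>
      \<not> (nat \<bar>u - w\<bar> \<in> D \<and> nat \<bar>w - v\<bar> \<in> D))" (is "?L \<longleftrightarrow> ?R")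
proof -
  have wf: "wf_digraph (distance_graph D)"
    by unfold_locales (auto simp: distance_graph_def)
  have V: "verts (distance_graph D) = UNIV" by (simp add: distance_graph_def)
  have gt1: "graph_dist (distance_graph D) u v > ereal (real 1) \<longleftrightarrow> nat \<bar>u - v\<bar> \<notin> D"
    and gt2: "graph_dist (distance_graph D) u v > ereal (real 2) \<longleftrightarrow>
      nat \<bar>u - v\<bar> \<notin> D \<and> (\<nexists>w. nat \<bar>u - w\<bar> \<in> D \<and> nat \<bar>w - v\<bar> \<in> D)"
    if "u \<noteq> v" for u v
    using graph_dist_gt_1_iff[OF wf _ that] graph_dist_gt_2_iff[OF wf _ that]
    unfolding dominates_distance_graph_iff V by blast+
  have far: "graph_dist (distance_graph D) u v > ereal (real (seq_1122 i)) \<longleftrightarrow>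
      nat \<bar>u - v\<bar> \<notin> D \<and> (3 \<le> i \<longrightarrow> (\<nexists>w. nat \<bar>u - w\<bar> \<in> D \<and> nat \<bar>w - v\<bar> \<in> D))"
    if "u \<noteq> v" for u v i
    using gt1[OF that] gt2[OF that] unfolding seq_1122_def by (cases "i \<le> 2") auto
  show ?thesis
  proof
    assume L: ?L
    then have range: "f v \<in> {1..l}" for v
      unfolding packing_coloring_def V by blast
    have "nat \<bar>u - v\<bar> \<notin> D \<and> (3 \<le> f u \<longrightarrow> (\<nexists>w. nat \<bar>u - w\<bar> \<in> D \<and> nat \<bar>w - v\<bar> \<in> D))"
      if "u \<noteq> v" "f u = f v" for u v
    proof -
      have "graph_dist (distance_graph D) u v > ereal (real (seq_1122 (f u)))"
        using L that range[of u] unfolding packing_coloring_def V by simp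
      then show ?thesis using far[OF \<open>u \<noteq> v\<close>] by blast
    qed
    with range show ?R by (metis atLeastAtMost_iff)
  next
    assume R: ?R
    show ?L unfolding packing_coloring_def V
    proof (intro conjI ballI impI)
      fix v show "f v \<in> {1..l}" using R by simp
    next
      fix i u v assume "u \<noteq> v \<and> f u = i \<and> f v = i"
      then have uv: "u \<noteq> v" "f u = i" "f v = i" by auto
      show "graph_dist (distance_graph D) u v > ereal (real (seq_1122 i))"
        unfolding far[OF uv(1)] using R uv by metis
    qed
  qed
qed

lemma packing_chromatic_number_eqI:
  assumes "1 \<le> m" "packing_coloring G S m f"
    and "\<And>l f. 1 \<le> l \<Longrightarrow> packing_coloring G S l f \<Longrightarrow> m \<le> l"
  shows "packing_chromatic_number G S = enat m"
  unfolding packing_chromatic_number_def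
  using assms by (intro cInf_eq_minimum) auto

section \<open>Colourings with two and with four colours\<close>

lemma parity_packing_coloring:
  assumes "odd k" "odd t"
  shows "packing_coloring (distance_graph {k, t}) seq_1122 2 (\<lambda>x. if even x then 1 else 2)"
proof -
  have "nat \<bar>u - v\<bar> \<notin> {k, t}" if "even u \<longleftrightarrow> even v" for u v :: int
  proof
    assume "nat \<bar>u - v\<bar> \<in> {k, t}"
    with assms have "odd (nat \<bar>u - v\<bar>)" by auto
    with that show False by (auto simp: even_nat_iff)
  qed
  then show ?thesis unfolding packing_coloring_1122_iff by auto
qed

text \<open>For \<open>c\<close> inverse to \<open>k\<close> modulo \<open>n\<close>,
  \<open>(x * c) mod n\<close> is the position of \<open>x\<close> on the cycle
  \<open>0, k, 2k, ...\<close>. Removing position 0 leaves a path, coloured by parity of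
  position.\<close>

definition cycle_coloring :: "int \<Rightarrow> int \<Rightarrow> int \<Rightarrow> nat" where
  "cycle_coloring n c x =
    (if (x * c) mod n = 0 then (if even (x div n) then 3 else 4)
     else if odd ((x * c) mod n) then 1 else 2)"

lemma cycle_packing_coloring:
  assumes "coprime k t" "0 < k" "k < t"
  shows "\<exists>f. packing_coloring (distance_graph {k, t}) seq_1122 4 f"
proof -
  define n where "n = int k + int t"
  have n: "n > 1" using assms by (simp add: n_def)
  have "coprime (int k) n"
    using assms(1) unfolding n_def by (metis coprime_iff_gcd_eq_1 coprime_int_iff gcd_add2)
  then obtain c where c: "[int k * c = 1] (mod n)"
    using cong_solve_coprime_int by blast
  define f where "f = cycle_coloring n c"
  \<comment> \<open>A step \<open>k\<close> advances the position by one, wrapping around after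
    \<open>n - 1\<close>.\<close>
  have step_k: "((x + int k) * c) mod n = (if (x * c) mod n = n - 1 then 0 else (x * c) mod n + 1)"
    for x
  proof -
    have "((x + int k) * c) mod n = ((x * c) mod n + (int k * c) mod n) mod n"
      by (simp add: distrib_right mod_add_eq)
    also have "(int k * c) mod n = 1"
      using c n by (simp add: cong_def)
    finally have eq: "((x + int k) * c) mod n = ((x * c) mod n + 1) mod n" .
    have "0 \<le> (x * c) mod n" "(x * c) mod n < n" using n by auto
    then show ?thesis
      unfolding eq
      by (cases "(x * c) mod n = n - 1") (simp_all add: mod_pos_pos_trivial del: mod_add_left_eq)
  qed
  \<comment> \<open>\<open>c\<close> is a unit modulo \<open>n\<close>, so only multiples of
    \<open>n\<close> have position 0.\<close>
  have mult_n: "n dvd x" if "(x * c) mod n = 0" for x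
  proof -
    have "coprime n c"
    proof -
      have "coprime (int k * c) n"
        using c by (metis cong_imp_coprime cong_sym coprime_1_left)
      then show ?thesis by (simp add: coprime_commute)
    qed
    with that show ?thesis
      by (metis coprime_dvd_mult_left_iff mod_0_imp_dvd)
  qed
  have far: "2 * n \<le> \<bar>u - v\<bar>" if uv: "u \<noteq> v" "f u = f v" "3 \<le> f u" for u v
  proof -
    have *: "(u * c) mod n = 0" "(v * c) mod n = 0" "even (u div n) = even (v div n)"
      using uv by (auto simp: f_def cycle_coloring_def split: if_splits)
    then obtain a b where ab: "u = n * a" "v = n * b" using mult_n by (meson dvdE)
    with * n uv(1) have "even (a - b)" "a \<noteq> b" by auto
    then have "2 \<le> \<bar>a - b\<bar>" by presburger
    then have "n * 2 \<le> n * \<bar>a - b\<bar>" using n by (intro mult_left_mono) auto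
    also have "\<dots> = \<bar>u - v\<bar>"
      using n by (simp add: ab right_diff_distrib[symmetric] abs_mult)
    finally show ?thesis by simp
  qed
  have proper_k: "f (x + int k) \<noteq> f x" for x
  proof
    assume eq: "f (x + int k) = f x"
    show False
    proof (cases "3 \<le> f x")
      case True
      then show False using far[of "x + int k" x] eq assms n by (simp add: n_def)
    next
      case False
      \<comment> \<open>Colours 1 and 2 exclude position 0, so there is no wrap, and consecutive
        positions differ in parity.\<close>
      then show False using eq step_k[of x]
        by (auto simp: f_def cycle_coloring_def split: if_splits)
    qed
  qed
  text \<open>A step \<open>t\<close> is a backward step \<open>k\<close> up to a multiple of \<open>n\<close>.\<close>
  have proper_t: "f (x + int t) \<noteq> f x" for x
  proof
    assume eq: "f (x + int t) = f x"
    show False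
    proof (cases "3 \<le> f x")
      case True
      then show False using far[of "x + int t" x] eq assms n by (simp add: n_def)
    next
      case False
      have "((x + int t + int k) * c) mod n = (x * c + n * c) mod n"
        by (simp add: n_def algebra_simps)
      also have "\<dots> = (x * c) mod n" by simp
      finally have "(x * c) mod n =
          (if ((x + int t) * c) mod n = n - 1 then 0 else ((x + int t) * c) mod n + 1)"
        using step_k[of "x + int t"] by (rule trans[OF sym])
      then show False using False eq
        by (auto simp: f_def cycle_coloring_def split: if_splits)
    qed
  qed
  have "packing_coloring (distance_graph {k, t}) seq_1122 4 f"
    unfolding packing_coloring_1122_iff
  proof (intro conjI allI impI)
    fix v show "1 \<le> f v" "f v \<le> 4" by (auto simp: f_def cycle_coloring_def)
  next
    fix u v assume uv: "u \<noteq> v \<and> f u = f v"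
    show "nat \<bar>u - v\<bar> \<notin> {k, t}"
    proof
      assume "nat \<bar>u - v\<bar> \<in> {k, t}"
      then have "\<bar>u - v\<bar> = int k \<or> \<bar>u - v\<bar> = int t" by auto
      then have "u = v + int k \<or> v = u + int k \<or> u = v + int t \<or> v = u + int t" by arith
      with uv proper_k[of u] proper_k[of v] proper_t[of u] proper_t[of v] show False by auto
    qed
  next
    fix u v w assume "u \<noteq> v \<and> f u = f v \<and> 3 \<le> f u"
    then have "2 * n \<le> \<bar>u - v\<bar>" using far by blast
    \<comment> \<open>Two steps cover at most \<open>2 * t\<close>, which is less than
      \<open>2 * n\<close>.\<close>
    then have "\<not> (\<bar>u - w\<bar> \<le> int t \<and> \<bar>w - v\<bar> \<le> int t)"
      using assms(2) unfolding n_def by arith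
    moreover have "\<bar>d\<bar> \<le> int t" if "nat \<bar>d\<bar> \<in> {k, t}" for d
      using that assms(3) by auto
    ultimately show "\<not> (nat \<bar>u - w\<bar> \<in> {k, t} \<and> nat \<bar>w - v\<bar> \<in> {k, t})" by blast
  qed
  then show ?thesis by blast
qed

section \<open>Impossibility of three colours for odd \<open>k + t\<close>\<close>

text \<open>Each of the \<open>m\<close> steps from 0 flips \<open>B\<close>. Two different step
  sizes reaching the same vertex can then be compared.\<close>

lemma alternating_bool:
  fixes B :: "int \<Rightarrow> bool"
  assumes "\<And>x. B (x + d) \<noteq> B x"
  shows "B (int m * d) \<longleftrightarrow> (B 0 \<longleftrightarrow> even m)"
proof (induction m)
  case (Suc m)
  have "int (Suc m) * d = int m * d + d" by (simp add: algebra_simps)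
  then show ?case using Suc assms[of "int m * d"] by auto
qed simp

lemma no_three_packing_coloring:
  assumes "0 < k" "k < t" "odd (k + t)"
    and "packing_coloring (distance_graph {k, t}) seq_1122 l f"
  shows "4 \<le> l"
proof (rule ccontr)
  assume "\<not> 4 \<le> l"
  have range: "f x = 1 \<or> f x = 2 \<or> f x = 3" for x
  proof -
    have "1 \<le> f x" "f x \<le> l"
      using assms(4) unfolding packing_coloring_1122_iff by blast+
    with \<open>\<not> 4 \<le> l\<close> show ?thesis by linarith
  qed
  have adj: "f u \<noteq> f v" if "nat \<bar>u - v\<bar> \<in> {k, t}" for u v
  proof -
    have "u \<noteq> v" using that assms(1,2) by auto
    with assms(4) that show ?thesis unfolding packing_coloring_1122_iff by blast
  qed
  have far: "f v \<noteq> 3"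
    if "f u = 3" "u \<noteq> v" "nat \<bar>u - w\<bar> \<in> {k, t}" "nat \<bar>w - v\<bar> \<in> {k, t}" for u v w
    using assms(4) that unfolding packing_coloring_1122_iff by (metis order_refl)
  have nbrs: "f (a + d) = f (a + e)"
    if a: "f a = 3" and d: "\<bar>d\<bar> = int k" and e: "\<bar>e\<bar> = int t" for a d e
  proof -
    \<comment> \<open>\<open>a + d + e\<close> is the corner of the 8-cycle between
      \<open>a + d\<close> and \<open>a + e\<close>. It is adjacent to both, so each has the other
      colour of 1 and 2.\<close>
    have "f (a + d + e) \<noteq> 3"
      using assms(1,2) d e by (intro far[of a _ "a + d"] a) auto
    moreover have "f (a + d) \<noteq> 3" "f (a + e) \<noteq> 3"
      using adj[of a "a + d"] adj[of a "a + e"] a d e by auto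
    moreover have "f (a + d) \<noteq> f (a + d + e)" "f (a + e) \<noteq> f (a + d + e)"
      using d e by (auto intro!: adj)
    ultimately show ?thesis
      using range[of "a + d"] range[of "a + e"] range[of "a + d + e"] by auto
  qed
  \<comment> \<open>\<open>B x\<close> says that \<open>x\<close> has colour 1 after the
    recolouring. By \<open>nbrs\<close>, the neighbour \<open>x + k\<close> can stand for all
    four.\<close>
  define B where "B x = (if f x = 3 then f (x + int k) \<noteq> 1 else f x = 1)" for x
  have B_step: "B (x + s) \<noteq> B x" if s: "s = int k \<or> s = int t" for x s
  proof -
    have neq: "f (x + s) \<noteq> f x" using s by (intro adj) auto
    consider "f x = 3" | "f (x + s) = 3" | "f x \<noteq> 3" "f (x + s) \<noteq> 3" by blast
    then show ?thesis
    proof cases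
      case 1
      then have "f (x + s) = f (x + int k)" using nbrs[of x "int k" "int t"] s by auto
      with 1 neq show ?thesis by (auto simp: B_def)
    next
      case 2
      have "f (x + s + int k) = f x"
        using s
      proof
        assume "s = int k"
        \<comment> \<open>Here \<open>x\<close> and \<open>x + 2k\<close> are opposite neighbours of
          \<open>x + s\<close> without a common corner, so both are compared with
          \<open>x + s + t\<close>.\<close>
        then show ?thesis using nbrs[of "x + s" "int k" "int t"] nbrs[of "x + s" "- int k" "int t"] 2
          by simp
      next
        assume "s = int t"
        then show ?thesis using nbrs[of "x + s" "int k" "- int t"] 2 by simp
      qed
      with 2 neq show ?thesis by (auto simp: B_def)
    next
      case 3
      with neq range[of x] range[of "x + s"] show ?thesis by (auto simp: B_def)
    qed
  qed
  \<comment> \<open>The vertex \<open>t * k\<close> is reached from 0 by \<open>t\<close> steps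
    \<open>k\<close> and also by \<open>k\<close> steps \<open>t\<close>, so the numbers of flips
    agree in parity.\<close>
  have "B (int t * int k) \<longleftrightarrow> (B 0 \<longleftrightarrow> even t)" "B (int k * int t) \<longleftrightarrow> (B 0 \<longleftrightarrow> even k)"
    using B_step by (auto intro!: alternating_bool)
  then have "even t \<longleftrightarrow> even k" by (auto simp: mult.commute)
  with assms(3) show False by auto
qed

theorem theorem3p1:
  fixes k t :: nat
  assumes "coprime k t" and "3 \<le> k" and "k < t"
  shows "packing_chromatic_number (distance_graph {k, t}) seq_1122 =
    (if even (k + t) then 2 else 4)"
proof (cases "even (k + t)")
  case True
  \<comment> \<open>An even sum gives equal parities, and coprimality excludes that both are
    even.\<close>
  with assms(1) have "odd k" "odd t"
    using coprime_common_divisor[of k t 2] by auto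
  have "packing_chromatic_number (distance_graph {k, t}) seq_1122 = enat 2"
  proof (rule packing_chromatic_number_eqI)
    fix l f assume "packing_coloring (distance_graph {k, t}) seq_1122 l f"
    then have range: "1 \<le> f v \<and> f v \<le> l"
      and proper: "u \<noteq> v \<Longrightarrow> nat \<bar>u - v\<bar> \<in> {k, t} \<Longrightarrow> f u \<noteq> f v" for u v
      unfolding packing_coloring_1122_iff by blast+
    have "f 0 \<noteq> f (int k)" using assms(2) by (intro proper) auto
    then show "2 \<le> l" using range[of 0] range[of "int k"] by linarith
  qed (use parity_packing_coloring \<open>odd k\<close> \<open>odd t\<close> in auto)
  with True show ?thesis by (simp add: numeral_eq_enat)
next
  case False
  obtain f where "packing_coloring (distance_graph {k, t}) seq_1122 4 f"
    using cycle_packing_coloring[of k t] assms by auto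
  then have "packing_chromatic_number (distance_graph {k, t}) seq_1122 = enat 4"
    using no_three_packing_coloring[of k t] assms False
    by (intro packing_chromatic_number_eqI) auto
  with False show ?thesis by (simp add: numeral_eq_enat)
qed

end
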